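(* Let $n\ge1$, $c=(c_1,\dots,c_{n+1})\in\mathbb{Z}_{\ge0}^{n+1}$, and $u=(1,\dots,1)\in\mathbb{Z}_{\ge0}^n$. Then $$B_c(u)=\lim_{i_{n+1}\to\infty}\frac{A_c(1,\dots,1,i_{n+1})}{(c_{n+1}+n)^{i_{n+1}}}=\frac{(c_{n+1}+n)^n}{n!}\sum_{\xi\in S_n}\prod_{k=1}^{n}\,(c_{\xi(k)}+c_{n+1}+k-1).$$
   Context: Let $e_1,\dots,e_{n+1}$ be the standard basis vectors of $\mathbb{Z}^{n+1}$. For $c\in\mathbb{Z}_{\ge0}^{n+1}$, the graph $E_c$ is the directed multigraph with vertex set $\mathbb{Z}_{\ge0}^{n+1}$ in which each vertex $i=(i_1,\dots,i_{n+1})$ is joined to $i+e_j$ by exactly $c_j+i_{n+1}$ directed edges for $1\le j\le n$, and to $i+e_{n+1}$ by exactly $c_{n+1}+i_1+\dots+i_n$ directed edges, and to no other vertices. For $i\in\mathbb{Z}_{\ge0}^{n+1}$, $A_c(i)$ denotes the number of directed paths in $E_c$ from $0$ to $i$. $S_n$ is the symmetric group on $\{1,\dots,n\}$. *)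

theory Defs
  imports Complex_Main "Graph_Theory.Arc_Walk" "HOL-Combinatorics.Permutations"
begin

text \<open>
  A vector of length \<open>n + 1\<close> over the naturals is a function \<^typ>\<open>nat \<Rightarrow> nat\<close> read at the
  indices \<open>1, \<dots>, n + 1\<close>. Vertices are required to vanish at all other indices, so that distinct
  functions are distinct vertices. For the parameter \<open>c\<close> no such normalisation is needed,
  since only its values at \<open>1, \<dots>, n + 1\<close> are ever used.
\<close>

type_synonym vec = "nat \<Rightarrow> nat"

definition vecs :: "nat \<Rightarrow> vec set" where
  "vecs d = {i. \<forall>j. j \<notin> {1..d} \<longrightarrow> i j = 0}"

definition add_unit :: "vec \<Rightarrow> nat \<Rightarrow> vec" where
  "add_unit i j = i(j := i j + 1)"

definition edge_mult :: "nat \<Rightarrow> vec \<Rightarrow> vec \<Rightarrow> nat \<Rightarrow> nat" where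
  "edge_mult n c i j =
     (if j \<le> n then c j + i (n + 1) else c (n + 1) + (\<Sum>k=1..n. i k))"

text \<open>The arc \<open>(i, j, l)\<close> is the \<open>l\<close>-th of the parallel arcs from \<open>i\<close> to \<open>i + e\<^sub>j\<close>.\<close>

definition E :: "nat \<Rightarrow> vec \<Rightarrow> (vec, vec \<times> nat \<times> nat) pre_digraph" where
  "E n c =
     \<lparr> verts = vecs (n + 1),
       arcs = {(i, j, l). i \<in> vecs (n + 1) \<and> j \<in> {1..n + 1} \<and> l < edge_mult n c i j},
       tail = (\<lambda>(i, j, l). i),
       head = (\<lambda>(i, j, l). add_unit i j) \<rparr>"

lemma wf_digraph_E: "wf_digraph (E n c)"
  by unfold_locales (auto simp: E_def vecs_def add_unit_def)

text \<open>
  Paths are counted as lists of arcs, so different choices among parallel arcs give different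
  paths. Every arc raises the coordinate sum by one and every vertex has finite out-degree, so
  the set of paths to a given vertex is finite.
\<close>

definition A :: "nat \<Rightarrow> vec \<Rightarrow> vec \<Rightarrow> nat" where
  "A n c i = card {p. pre_digraph.apath (E n c) (\<lambda>_. 0) p i}"

text \<open>
  \<open>A_ratio n c i m\<close> is \<open>A\<^sub>c(i\<^sub>1, \<dots>, i\<^sub>n, m) / (c\<^sub>n\<^sub>+\<^sub>1 + i\<^sub>1 + \<dots> + i\<^sub>n)\<^sup>m\<close>, whose limit
  as \<open>m\<close> tends to infinity is \<open>B\<^sub>c(i\<^sub>1, \<dots>, i\<^sub>n)\<close>. The constant \<^const>\<open>lim\<close> is meaningful
  only for a convergent sequence.
\<close>

definition A_ratio :: "nat \<Rightarrow> vec \<Rightarrow> vec \<Rightarrow> nat \<Rightarrow> real" where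
  "A_ratio n c i m =
     real (A n c (i(n + 1 := m))) / real (c (n + 1) + (\<Sum>k=1..n. i k)) ^ m"

definition B :: "nat \<Rightarrow> vec \<Rightarrow> vec \<Rightarrow> real" where
  "B n c i = lim (A_ratio n c i)"

definition ones :: "nat \<Rightarrow> vec" where
  "ones n = (\<lambda>j. if j \<in> {1..n} then 1 else 0)"

end

theory Submission
  imports Defs "HOL-Computational_Algebra.Polynomial" "HOL-Combinatorics.Multiset_Permutations"
begin

text \<open>
  Write \<open>d = c\<^sub>n\<^sub>+\<^sub>1\<close> and let \<open>a(S, m)\<close> be the number of paths to the vertex whose first \<open>n\<close>
  coordinates are the indicator of \<open>S\<close> and whose last one is \<open>m\<close>. Splitting off the last arc,
  \<open>a(S, m) = (d + |S|) a(S, m - 1) + (\<Sum>j\<in>S. (c\<^sub>j + m) a(S - {j}, m))\<close>. The solution is symmetric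
  and multilinear in the \<open>c\<^sub>j\<close>, so it is the polarisation of its restriction to the diagonal
  \<open>c\<^sub>j = x\<close>. There the recurrence is that of the generalised Eulerian numbers, which have an
  explicit expression as an alternating sum of terms \<open>(d + j) ^ (s + m)\<close> for \<open>j \<le> s = |S|\<close>, times
  products of \<open>s\<close> linear factors in \<open>x\<close>. After division by \<open>(d + s) ^ m\<close> only the term \<open>j = s\<close>
  survives in the limit, and its polarisation is the sum over permutations.
\<close>

section \<open>Polarisation\<close>

text \<open>
  Polarisation: \<open>polar c S\<close> is linear and sends \<open>x\<^sup>k\<close> to the mean of \<open>\<Prod>t\<in>T. c t\<close> over the
  subsets \<open>T\<close> of \<open>S\<close> of size \<open>k\<close>. It is only meaningful in degree at most \<open>card S\<close>; higher
  coefficients are ignored.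
\<close>

definition polar :: "('a \<Rightarrow> real) \<Rightarrow> 'a set \<Rightarrow> real poly \<Rightarrow> real" where
  "polar c S p = (\<Sum>T\<in>Pow S. (\<Prod>t\<in>T. c t) * coeff p (card T) / real (card S choose card T))"

lemma polar_add: "polar c S (p + q) = polar c S p + polar c S q"
  by (simp add: polar_def sum.distrib[symmetric] ring_distribs add_divide_distrib)

lemma polar_smult: "polar c S (smult a p) = a * polar c S p"
  by (simp add: polar_def sum_distrib_left mult_ac)

lemma polar_sum: "polar c S (\<Sum>i\<in>I. f i) = (\<Sum>i\<in>I. polar c S (f i))"
proof (induction I rule: infinite_finite_induct)
  case (insert i I)
  then show ?case by (simp add: polar_add)
qed (simp_all add: polar_def)

lemma polar_empty: "polar c {} p = coeff p 0"
  by (simp add: polar_def)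

lemma sum_Pow_remove:
  assumes "finite S"
  shows "(\<Sum>x\<in>S. \<Sum>T\<in>Pow (S - {x}). h x T) = (\<Sum>T\<in>Pow S. \<Sum>x\<in>S - T. h x T)"
proof -
  have "(\<Sum>x\<in>S. \<Sum>T\<in>{T\<in>Pow S. x \<notin> T}. h x T) = (\<Sum>T\<in>Pow S. \<Sum>x\<in>{x\<in>S. x \<notin> T}. h x T)"
    using assms by (intro sum.swap_restrict) auto
  moreover have "{T\<in>Pow S. x \<notin> T} = Pow (S - {x})" for x by auto
  moreover have "{x\<in>S. x \<notin> T} = S - T" for T by auto
  ultimately show ?thesis by simp
qed

text \<open>\<open>insert x\<close> maps the subsets avoiding \<open>x\<close> bijectively onto
  those containing \<open>x\<close>; then the order of summation is exchanged.\<close>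

lemma sum_Pow_insert:
  assumes "finite S"
  shows "(\<Sum>x\<in>S. \<Sum>T\<in>Pow (S - {x}). h x (insert x T)) = (\<Sum>T\<in>Pow S. \<Sum>x\<in>T. h x T)"
proof -
  have "(\<Sum>x\<in>S. \<Sum>T\<in>Pow (S - {x}). h x (insert x T)) = (\<Sum>x\<in>S. \<Sum>T\<in>{T\<in>Pow S. x \<in> T}. h x T)"
    by (intro sum.cong sum.reindex_bij_witness[of _ "\<lambda>T. T - {_}" "insert _"] refl)
       (auto simp: insert_absorb)
  also have "\<dots> = (\<Sum>T\<in>Pow S. \<Sum>x\<in>{x\<in>S. x \<in> T}. h x T)"
    using assms by (intro sum.swap_restrict) auto
  also have "\<dots> = (\<Sum>T\<in>Pow S. \<Sum>x\<in>T. h x T)"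
    by (intro sum.cong refl) auto
  finally show ?thesis .
qed

text \<open>Turns a linear factor on the diagonal into the sum over the last arc in the path
  recurrence. For \<open>card T = k\<close>, the product over \<open>T\<close> arises on the right
  from the \<open>s - k\<close> elements outside \<open>T\<close> with factor \<open>a\<close>, and
  from the \<open>k\<close> elements of \<open>T\<close> with factor \<open>c x\<close>; absorption
  identities for binomials match the weights.\<close>

lemma polar_mult_linear:
  assumes "finite S" "degree p < card S"
  shows "real (card S) * polar c S ([:a, 1:] * p) = (\<Sum>x\<in>S. (c x + a) * polar c (S - {x}) p)"
proof -
  define s where "s = card S"
  \<comment> \<open>All sets \<open>S - {x}\<close> have size \<open>s - 1\<close>, so they share
    this weight.\<close>
  define w where "w k = coeff p k / real ((s - 1) choose k)" for k
  have "polar c (S - {x}) p = (\<Sum>T\<in>Pow (S - {x}). (\<Prod>t\<in>T. c t) * w (card T))" if "x \<in> S" for x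
    using that assms by (simp add: polar_def w_def s_def)
  then have "(\<Sum>x\<in>S. (c x + a) * polar c (S - {x}) p) =
     (\<Sum>x\<in>S. \<Sum>T\<in>Pow (S - {x}). (c x + a) * ((\<Prod>t\<in>T. c t) * w (card T)))"
    by (simp add: sum_distrib_left)
  \<comment> \<open>The weight is written through \<open>insert x T\<close>, the shape that
    \<open>sum_Pow_insert\<close> expects.\<close>
  also have "\<dots> = (\<Sum>x\<in>S. \<Sum>T\<in>Pow (S - {x}). a * ((\<Prod>t\<in>T. c t) * w (card T))) +
     (\<Sum>x\<in>S. \<Sum>T\<in>Pow (S - {x}). (\<Prod>t\<in>insert x T. c t) * w (card (insert x T) - 1))"
    unfolding sum.distrib[symmetric]
  proof (intro sum.cong refl)
    fix x T assume "x \<in> S" "T \<in> Pow (S - {x})"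
    then have "finite T" "x \<notin> T" using assms finite_subset by auto
    then show "(c x + a) * ((\<Prod>t\<in>T. c t) * w (card T)) =
       a * ((\<Prod>t\<in>T. c t) * w (card T)) + (\<Prod>t\<in>insert x T. c t) * w (card (insert x T) - 1)"
      by (simp add: algebra_simps)
  qed
  also have "\<dots> = (\<Sum>T\<in>Pow S. \<Sum>x\<in>S - T. a * ((\<Prod>t\<in>T. c t) * w (card T))) +
     (\<Sum>T\<in>Pow S. \<Sum>x\<in>T. (\<Prod>t\<in>T. c t) * w (card T - 1))"
    using assms(1) sum_Pow_insert[of S "\<lambda>x T. (\<Prod>t\<in>T. c t) * w (card T - 1)"]
    by (simp add: sum_Pow_remove)
  also have "\<dots> = (\<Sum>T\<in>Pow S. real s * ((\<Prod>t\<in>T. c t) * coeff ([:a, 1:] * p) (card T) / real (s choose card T)))"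
    unfolding sum.distrib[symmetric]
  proof (intro sum.cong refl)
    fix T assume T: "T \<in> Pow S"
    define k where "k = card T"
    have ks: "k \<le> s" using T assms by (simp add: k_def s_def card_mono)
    \<comment> \<open>At \<open>k = s\<close> the left side is 0, and the degree bound kills the
      coefficient on the right.\<close>
    have 1: "real (s - k) * w k = real s * coeff p k / real (s choose k)"
    proof (cases "k = s")
      case True
      then show ?thesis using assms by (simp add: coeff_eq_0 s_def)
    next
      case False
      have "real (s - k) * real (s choose k) = real s * real (s - 1 choose k)"
        using binomial_absorb_comp[of s k] by (metis of_nat_mult)
      then have "real (s - k) / real (s - 1 choose k) = real s / real (s choose k)"
        using False ks by (subst frac_eq_eq) auto
      then show ?thesis
        by (simp add: w_def times_divide_eq_left[symmetric] mult.commute[of "coeff p k"]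
            del: times_divide_eq_left of_nat_diff)
    qed
    have 2: "real k * w (k - 1) = real s * (coeff ([:a, 1:] * p) k - a * coeff p k) / real (s choose k)"
    proof (cases k)
      case (Suc k')
      have "real k * real (s choose k) = real s * real (s - 1 choose k')"
        using binomial_absorption[of k' s] Suc by (metis of_nat_mult)
      then have "real k / real (s - 1 choose k') = real s / real (s choose k)"
        using Suc ks by (simp add: frac_eq_eq)
      moreover have "coeff ([:a, 1:] * p) k - a * coeff p k = coeff p k'"
        by (simp add: Suc)
      ultimately show ?thesis
        by (simp add: w_def Suc times_divide_eq_left[symmetric] del: times_divide_eq_left of_nat_Suc mult_pCons_left)
    qed simp
    have "card (S - T) = s - k" using T assms by (simp add: k_def s_def card_Diff_subset finite_subset)
    then have "(\<Sum>x\<in>S - T. a * ((\<Prod>t\<in>T. c t) * w (card T))) + (\<Sum>x\<in>T. (\<Prod>t\<in>T. c t) * w (card T - 1))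
       = (\<Prod>t\<in>T. c t) * (a * (real (s - k) * w k) + real k * w (k - 1))"
      by (simp add: k_def[symmetric] algebra_simps)
    also have "\<dots> = real s * ((\<Prod>t\<in>T. c t) * coeff ([:a, 1:] * p) k / real (s choose k))"
      unfolding 1 2 by (simp add: algebra_simps diff_divide_distrib add_divide_distrib)
    finally show "(\<Sum>x\<in>S - T. a * ((\<Prod>t\<in>T. c t) * w (card T))) + (\<Sum>x\<in>T. (\<Prod>t\<in>T. c t) * w (card T - 1))
       = real s * ((\<Prod>t\<in>T. c t) * coeff ([:a, 1:] * p) (card T) / real (s choose card T))"
      by (simp only: k_def)
  qed
  finally show ?thesis by (simp add: polar_def s_def sum_distrib_left)
qed

lemma degree_prod_linear: "degree (\<Prod>k<s. [:a k, 1:] :: real poly) = s"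
  by (induction s) (simp_all add: degree_mult_eq prod_zero_iff del: mult_pCons_left mult_pCons_right)

text \<open>Induction on \<open>card S\<close>: \<open>polar_mult_linear\<close> peels off the
  factor at index 0, and the element \<open>x\<close> it removes becomes the head of the list. The
  remaining factors use the shifted sequence, hence \<open>a\<close> is arbitrary.\<close>

lemma polar_prod_linear:
  assumes "finite S"
  shows "fact (card S) * polar c S (\<Prod>k<card S. [:a k, 1:]) =
    (\<Sum>xs\<in>permutations_of_set S. \<Prod>k<card S. c (xs ! k) + a k)"
  using assms
proof (induction "card S" arbitrary: S a)
  case 0
  then show ?case by (simp add: polar_empty)
next
  case (Suc s)
  have S: "finite S" "S \<noteq> {}" and s: "card S = Suc s" using Suc by auto
  define p where "p = (\<Prod>k<s. [:a (Suc k), 1:])"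
  have disj: "(\<Sum>xs\<in>permutations_of_set S. f xs) =
      (\<Sum>x\<in>S. \<Sum>xs\<in>permutations_of_set (S - {x}). f (x # xs))" for f :: "'a list \<Rightarrow> real"
    by (subst permutations_of_set_nonempty[OF S(2)], subst sum.UNION_disjoint)
       (use S in \<open>auto simp: sum.reindex inj_on_def\<close>)
  have "(\<Sum>xs\<in>permutations_of_set S. \<Prod>k<Suc s. c (xs ! k) + a k) =
      (\<Sum>x\<in>S. (c x + a 0) * (\<Sum>xs\<in>permutations_of_set (S - {x}). \<Prod>k<s. c (xs ! k) + a (Suc k)))"
    by (simp add: disj prod.lessThan_Suc_shift sum_distrib_left del: prod.lessThan_Suc)
  also have "\<dots> = (\<Sum>x\<in>S. (c x + a 0) * (fact s * polar c (S - {x}) p))"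
  proof (intro sum.cong refl)
    fix x assume "x \<in> S"
    then have "s = card (S - {x})" using s S by simp
    from Suc(1)[OF this, of "\<lambda>k. a (Suc k)"] this S
    show "(c x + a 0) * (\<Sum>xs\<in>permutations_of_set (S - {x}). \<Prod>k<s. c (xs ! k) + a (Suc k)) =
       (c x + a 0) * (fact s * polar c (S - {x}) p)"
      by (simp add: p_def)
  qed
  also have "\<dots> = fact s * (\<Sum>x\<in>S. (c x + a 0) * polar c (S - {x}) p)"
    by (simp add: sum_distrib_left mult_ac)
  also have "\<dots> = fact s * (real (Suc s) * polar c S ([:a 0, 1:] * p))"
    using polar_mult_linear[of S p c "a 0"] S s by (simp add: p_def degree_prod_linear del: of_nat_Suc mult_pCons_left)
  also have "[:a 0, 1:] * p = (\<Prod>k<Suc s. [:a k, 1:])"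
    by (simp only: p_def prod.lessThan_Suc_shift)
  finally show ?case using s by simp
qed

section \<open>Generalised Eulerian numbers\<close>

text \<open>Up to sign this is the finite difference of order \<open>s\<close> of a polynomial of
  degree \<open>r < s\<close>. One factor \<open>x + j\<close> is split; its part \<open>j\<close>
  is absorbed into the binomial, which lowers \<open>s\<close> by one and moves \<open>x\<close> to
  \<open>x + 1\<close>.\<close>

lemma sum_alternating_power_eq_0:
  fixes x :: "'a::comm_ring_1"
  assumes "r < s"
  shows "(\<Sum>j\<le>s. (-1) ^ j * of_nat (s choose j) * (x + of_nat j) ^ r) = 0"
  using assms
proof (induction r arbitrary: s x)
  case 0
  then show ?case by (simp add: choose_alternating_sum)
next
  case (Suc r)
  then obtain t where t: "s = Suc t" "r < t" by (cases s) auto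
  have "(\<Sum>j\<le>s. (-1) ^ j * of_nat (s choose j) * (x + of_nat j) ^ Suc r) =
      x * (\<Sum>j\<le>s. (-1) ^ j * of_nat (s choose j) * (x + of_nat j) ^ r) +
      (\<Sum>j\<le>s. (-1) ^ j * of_nat (j * (s choose j)) * (x + of_nat j) ^ r)"
    by (simp add: sum_distrib_left sum.distrib[symmetric] algebra_simps)
  also have "(\<Sum>j\<le>s. (-1) ^ j * of_nat (s choose j) * (x + of_nat j) ^ r) = 0"
    using Suc by simp
  also have "(\<Sum>j\<le>s. (-1) ^ j * of_nat (j * (s choose j)) * (x + of_nat j) ^ r) =
      (\<Sum>j\<le>t. (-1) ^ Suc j * of_nat (Suc j * (Suc t choose Suc j)) * (x + of_nat (Suc j)) ^ r)"
    unfolding t by (subst sum.atMost_Suc_shift) simp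
  also have "\<dots> = (\<Sum>j\<le>t. - of_nat s * ((-1) ^ j * of_nat (t choose j) * ((x + 1) + of_nat j) ^ r))"
    unfolding Suc_times_binomial t of_nat_mult by (intro sum.cong refl) (simp add: algebra_simps)
  also have "\<dots> = - of_nat s * (\<Sum>j\<le>t. (-1) ^ j * of_nat (t choose j) * ((x + 1) + of_nat j) ^ r)"
    by (simp add: sum_distrib_left)
  also have "\<dots> = 0"
    using Suc.IH[OF t(2), of "x + 1"] by simp
  finally show ?case by simp
qed

text \<open>
  After division by \<open>s!\<close> this is the explicit formula of Carlitz and Scoville for the generalised
  Eulerian numbers \<open>p(s, m) = (d + s) p(s, m - 1) + (x + m) p(s - 1, m)\<close>, regarded as a polynomial
  in \<open>x\<close>. The index is shifted, \<open>M = m + 1\<close>, so that \<open>M = 0\<close> is the vanishing row \<open>m = -1\<close>; the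
  truncated exponent \<open>s + M - 1\<close> is harmful only for \<open>s = M = 0\<close>, which is never used.
\<close>

definition eulerian_shift :: "real \<Rightarrow> nat \<Rightarrow> nat \<Rightarrow> nat \<Rightarrow> real" where
  "eulerian_shift d M j k = (if k < j then d else d + real M) + real k"

definition eulerian_poly :: "real \<Rightarrow> nat \<Rightarrow> nat \<Rightarrow> real poly" where
  "eulerian_poly d s M = (\<Sum>j\<le>s. smult ((-1) ^ (s - j) * real (s choose j) * (d + real j) ^ (s + M - 1))
     (\<Prod>k<s. [:eulerian_shift d M j k, 1:]))"

lemma eulerian_poly_0: "eulerian_poly d 0 (Suc m) = [:d ^ m:]"
  by (simp add: eulerian_poly_def)

text \<open>For \<open>M = 0\<close> the shifts do not depend on \<open>j\<close>, so the product
  factors out and leaves a difference of order \<open>t + 1\<close> of a power of exponent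
  \<open>t\<close>.\<close>

lemma eulerian_poly_Suc_0: "eulerian_poly d (Suc t) 0 = 0"
proof -
  have "(\<Sum>j\<le>Suc t. (-1) ^ (Suc t - j) * real (Suc t choose j) * (d + real j) ^ t) =
      (-1) ^ Suc t * (\<Sum>j\<le>Suc t. (-1) ^ j * real (Suc t choose j) * (d + real j) ^ t)"
    unfolding sum_distrib_left
    by (intro sum.cong refl) (simp add: power_diff_conv_inverse mult.assoc[symmetric])
  also have "\<dots> = 0"
    by (simp only: sum_alternating_power_eq_0[OF lessI] mult_zero_right)
  moreover have "eulerian_shift d 0 j k = d + real k" for j k
    by (simp add: eulerian_shift_def)
  ultimately show ?thesis
    by (simp add: eulerian_poly_def smult_sum[symmetric] del: sum.atMost_Suc prod.lessThan_Suc)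
qed

lemma degree_eulerian_poly: "degree (eulerian_poly d s M) \<le> s"
  unfolding eulerian_poly_def
  by (intro degree_sum_le) (auto intro!: order.trans[OF degree_smult_le] simp: degree_prod_linear)

text \<open>Checked pointwise in \<open>x\<close> and separately for each \<open>j\<close>: for
  \<open>j \<le> t\<close> all three products are multiples of \<open>R t (Suc M) j\<close>, and the
  term \<open>j = Suc t\<close> involves only the first two polynomials.\<close>

lemma eulerian_poly_Suc_Suc:
  "eulerian_poly d (Suc t) (Suc M) =
     smult (d + real (Suc t)) (eulerian_poly d (Suc t) M) +
     smult (real (Suc t)) ([:real M, 1:] * eulerian_poly d t (Suc M))"
proof (rule poly_ext)
  fix x :: real
  define R where "R s M j = (\<Prod>k<s. x + eulerian_shift d M j k)" for s M j
  have P: "poly (eulerian_poly d s M) x =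
     (\<Sum>j\<le>s. (-1) ^ (s - j) * real (s choose j) * (d + real j) ^ (s + M - 1) * R s M j)" for s M
    by (simp add: eulerian_poly_def poly_sum poly_prod R_def add.commute)
  \<comment> \<open>Passing to \<open>Suc M\<close> turns the factor at \<open>k \<ge> j\<close>
    into the one at \<open>k + 1\<close> for \<open>M\<close>, so only the factor at
    \<open>k = j\<close> is left over.\<close>
  have shift: "R (Suc t) M j = (x + d + real M + real j) * R t (Suc M) j" if "j \<le> t" for t j
    using that
  proof (induction t rule: dec_induct)
    case base
    then show ?case by (simp add: R_def eulerian_shift_def add_ac)
  next
    case (step t)
    then show ?case by (simp add: R_def eulerian_shift_def algebra_simps)
  qed
  have last: "R (Suc t) (Suc M) j = (x + d + real M + 1 + real t) * R t (Suc M) j" if "j \<le> t" for j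
    using that by (simp add: R_def eulerian_shift_def add_ac)
  have top: "R (Suc t) (Suc M) (Suc t) = R (Suc t) M (Suc t)"
    by (simp add: R_def eulerian_shift_def)
  define C where "C j = (-1) ^ (t - j) * (d + real j) ^ (t + M)" for j
  have summand: "(-1) ^ (Suc t - j) * real (Suc t choose j) * (d + real j) ^ Suc (t + M) * R (Suc t) (Suc M) j =
      (d + real (Suc t)) * ((-1) ^ (Suc t - j) * real (Suc t choose j) * (d + real j) ^ (t + M) * R (Suc t) M j) +
      real (Suc t) * ((x + real M) * ((-1) ^ (t - j) * real (t choose j) * (d + real j) ^ (t + M) * R t (Suc M) j))"
    if "j \<le> t" for j
  proof -
    have absorb: "real (Suc t) * real (t choose j) = (real (Suc t) - real j) * real (Suc t choose j)"
      using binomial_absorb_comp[of "Suc t" j] that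
      by (metis diff_Suc_1 le_SucI of_nat_diff of_nat_mult)
    have "(d + real (Suc t)) * ((-1) ^ (Suc t - j) * real (Suc t choose j) * (d + real j) ^ (t + M) * R (Suc t) M j) +
      real (Suc t) * ((x + real M) * ((-1) ^ (t - j) * real (t choose j) * (d + real j) ^ (t + M) * R t (Suc M) j)) =
      C j * R t (Suc M) j * ((x + real M) * (real (Suc t) * real (t choose j)) -
        real (Suc t choose j) * (d + real (Suc t)) * (x + d + real M + real j))"
      using that by (simp add: C_def shift Suc_diff_le algebra_simps)
    \<comment> \<open>With \<open>y = x + M\<close> and \<open>s = t + 1\<close>: \<open>y * (s - j)
      - (d + s) * (y + d + j) = - (d + j) * (y + d + s)\<close>.\<close>
    also have "\<dots> = - C j * R t (Suc M) j * real (Suc t choose j) * (d + real j) * (x + d + real M + 1 + real t)"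
      unfolding absorb by (simp add: algebra_simps)
    also have "\<dots> = (-1) ^ (Suc t - j) * real (Suc t choose j) * (d + real j) ^ Suc (t + M) * R (Suc t) (Suc M) j"
      using that by (simp add: C_def last Suc_diff_le)
    finally show ?thesis by simp
  qed
  have "poly (eulerian_poly d (Suc t) (Suc M)) x =
      (\<Sum>j\<le>t. (-1) ^ (Suc t - j) * real (Suc t choose j) * (d + real j) ^ Suc (t + M) * R (Suc t) (Suc M) j) +
      (d + real (Suc t)) * ((d + real (Suc t)) ^ (t + M) * R (Suc t) M (Suc t))"
    by (simp add: P top)
  also have "\<dots> = (d + real (Suc t)) * poly (eulerian_poly d (Suc t) M) x +
      real (Suc t) * ((x + real M) * poly (eulerian_poly d t (Suc M)) x)"
    by (simp add: P summand sum.distrib sum_distrib_left[symmetric] ring_distribs(1)[of "d + (1 + real t)"]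
        del: power_Suc)
  finally show "poly (eulerian_poly d (Suc t) (Suc M)) x = poly (smult (d + real (Suc t)) (eulerian_poly d (Suc t) M) +
     smult (real (Suc t)) ([:real M, 1:] * eulerian_poly d t (Suc M))) x"
    by (simp add: algebra_simps del: of_nat_Suc)
qed

text \<open>Induction on \<open>K\<close>, splitting \<open>r ^ m\<close> into two copies of
  \<open>sqrt r ^ m\<close>: one beats the new linear factor, the other serves the induction
  hypothesis at \<open>sqrt r\<close>.\<close>

lemma power_mult_prod_linear_tendsto_0:
  fixes r :: real
  assumes "0 \<le> r" "r < 1" "finite K"
  shows "(\<lambda>m. r ^ m * (\<Prod>k\<in>K. \<alpha> k + \<beta> k * real m)) \<longlonglongrightarrow> 0"
  using assms(3,1,2)
proof (induction K arbitrary: r)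
  case empty
  then show ?case by (simp add: LIMSEQ_power_zero)
next
  case (insert k K)
  have q: "0 \<le> sqrt r" "sqrt r < 1" using insert by (auto simp: real_sqrt_lt_1_iff)
  have "(\<lambda>m. (\<alpha> k * sqrt r ^ m + \<beta> k * (real m * sqrt r ^ m)) *
      (sqrt r ^ m * (\<Prod>k\<in>K. \<alpha> k + \<beta> k * real m))) \<longlonglongrightarrow> (\<alpha> k * 0 + \<beta> k * 0) * 0"
    using q by (intro tendsto_intros LIMSEQ_power_zero powser_times_n_limit_0 insert.IH) auto
  moreover have "(\<alpha> k * sqrt r ^ m + \<beta> k * (real m * sqrt r ^ m)) * (sqrt r ^ m * (\<Prod>k\<in>K. \<alpha> k + \<beta> k * real m))
     = r ^ m * (\<Prod>k\<in>insert k K. \<alpha> k + \<beta> k * real m)" for m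
  proof -
    have "sqrt r ^ m * sqrt r ^ m = r ^ m"
      using insert by (simp add: power_mult_distrib[symmetric])
    then have *: "sqrt r ^ m * (sqrt r ^ m * z) = r ^ m * z" for z
      by (simp add: mult.assoc[symmetric])
    show ?thesis using insert by (simp add: algebra_simps *)
  qed
  ultimately show ?case by simp
qed

section \<open>Counting paths\<close>

lemma sum_add_unit:
  assumes "j \<in> {1..d}"
  shows "(\<Sum>k=1..d. add_unit i j k) = Suc (\<Sum>k=1..d. i k)"
proof -
  have "(\<Sum>k=1..d. add_unit i j k) = (\<Sum>k=1..d. i k + (if j = k then 1 else 0))"
    by (intro sum.cong) (auto simp: add_unit_def)
  then show ?thesis using assms by (simp add: sum.distrib del: One_nat_def)
qed

lemma E_simps:
  "verts (E n c) = vecs (n + 1)"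
  "tail (E n c) (i, j, l) = i"
  "head (E n c) (i, j, l) = add_unit i j"
  "(i, j, l) \<in> arcs (E n c) \<longleftrightarrow> i \<in> vecs (n + 1) \<and> j \<in> {1..n + 1} \<and> l < edge_mult n c i j"
  by (simp_all add: E_def)

text \<open>Every arc raises the coordinate sum, so a walk never returns to a vertex. The induction
  also carries a lower bound on the sums of visited vertices, which separates the start from all
  later ones.\<close>

lemma apath_E_iff: "pre_digraph.apath (E n c) u p v \<longleftrightarrow> pre_digraph.awalk (E n c) u p v"
proof -
  interpret wf_digraph "E n c" by (rule wf_digraph_E)
  have "distinct (awalk_verts u p) \<and>
      (\<forall>w\<in>set (awalk_verts u p). (\<Sum>k=1..n+1. u k) \<le> (\<Sum>k=1..n+1. w k))" if "awalk u p v"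
    using that
  proof (induction p arbitrary: u)
    case (Cons e p)
    obtain i j l where e: "e = (i, j, l)" by (cases e)
    from Cons.prems have w: "awalk (add_unit i j) p v" "i = u" "j \<in> {1..n+1}"
      by (auto simp: awalk_Cons_iff E_simps e)
    have s: "(\<Sum>k=1..n+1. add_unit u j k) = Suc (\<Sum>k=1..n+1. u k)"
      using sum_add_unit[OF w(3)] .
    have v: "awalk_verts u (e # p) = u # awalk_verts (add_unit u j) p"
      using w by (simp add: E_simps e)
    show ?case unfolding v
      using Cons.IH[OF w(1)] s w(2) by (force simp del: One_nat_def sum.cl_ivl_Suc)
  qed simp
  then show ?thesis by (auto simp: apath_def)
qed

definition predec :: "vec \<Rightarrow> nat \<Rightarrow> vec" where "predec v j = v(j := v j - 1)"

text \<open>The last arc into \<open>v\<close> is fixed by its direction \<open>j\<close> and its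
  label \<open>l\<close>, since its tail must be \<open>predec v j\<close>.\<close>

lemma awalks_snoc:
  assumes "v \<in> vecs (n + 1)"
  shows "{p. pre_digraph.awalk (E n c) (\<lambda>_. 0) p v} =
    (if v = (\<lambda>_. 0) then {[]} else {}) \<union>
    (\<Union>j\<in>{j\<in>{1..n+1}. v j > 0}. \<Union>l<edge_mult n c (predec v j) j.
       (\<lambda>p. p @ [(predec v j, j, l)]) ` {p. pre_digraph.awalk (E n c) (\<lambda>_. 0) p (predec v j)})"
    (is "?L = ?R")
proof -
  interpret wf_digraph "E n c" by (rule wf_digraph_E)
  have awalk_snoc: "awalk u (p @ [(i, j, l)]) v \<longleftrightarrow> awalk u p i \<and> i \<in> vecs (n + 1) \<and> j \<in> {1..n+1} \<and>
      l < edge_mult n c i j \<and> v = add_unit i j" for u p i j l v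
    by (auto simp: awalk_Cons_iff awalk_Nil_iff E_simps vecs_def add_unit_def)
  have pre: "v = add_unit i j \<longleftrightarrow> v j > 0 \<and> i = predec v j" for i j
    by (auto simp: add_unit_def predec_def fun_eq_iff)
  show ?thesis
  proof (intro set_eqI)
    fix p
    show "p \<in> ?L \<longleftrightarrow> p \<in> ?R"
    proof (cases p rule: rev_cases)
      case Nil
      then show ?thesis using assms by (auto simp: awalk_Nil_iff E_simps vecs_def)
    next
      case (snoc q e)
      obtain i j l where e: "e = (i, j, l)" by (cases e)
      have "predec v j \<in> vecs (n+1)" using assms by (auto simp: predec_def vecs_def)
      then show ?thesis by (auto simp: snoc e awalk_snoc pre simp del: awalk_append_iff)
    qed
  qed
qed

lemma predec_in_vecs: "v \<in> vecs d \<Longrightarrow> predec v j \<in> vecs d"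
  by (auto simp: predec_def vecs_def)

text \<open>Induction on the coordinate sum. Finiteness is what lets \<open>card\<close> be added up
  over the pieces of \<open>awalks_snoc\<close>.\<close>

lemma finite_awalks:
  assumes "v \<in> vecs (n + 1)"
  shows "finite {p. pre_digraph.awalk (E n c) (\<lambda>_. 0) p v}"
  using assms
proof (induction "\<Sum>k=1..n+1. v k" arbitrary: v rule: less_induct)
  case less
  have "finite {p. pre_digraph.awalk (E n c) (\<lambda>_. 0) p (predec v j)}"
    if j: "j \<in> {1..n+1}" "v j > 0" for j
  proof -
    have "add_unit (predec v j) j = v"
      using j by (simp add: add_unit_def predec_def)
    with sum_add_unit[OF j(1), of "predec v j"]
    have "(\<Sum>k=1..n+1. predec v j k) < (\<Sum>k=1..n+1. v k)" by simp
    then show ?thesis using less predec_in_vecs by blast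
  qed
  then show ?case
    by (subst awalks_snoc[OF less.prems]) (auto simp del: Suc_eq_plus1)
qed

text \<open>The pieces of \<open>awalks_snoc\<close> are disjoint because their last arcs differ,
  and appending a fixed arc is injective.\<close>

lemma A_rec:
  assumes "v \<in> vecs (n + 1)"
  shows "A n c v = (if v = (\<lambda>_. 0) then 1 else 0) +
    (\<Sum>j | j \<in> {1..n+1} \<and> v j > 0. edge_mult n c (predec v j) j * A n c (predec v j))"
proof -
  define W where "W v = {p. pre_digraph.awalk (E n c) (\<lambda>_. 0) p v}" for v
  have fin: "finite (W (predec v j))" for j
    unfolding W_def by (intro finite_awalks predec_in_vecs assms)
  have "card ((\<lambda>p. p @ [e]) ` X) = card X" for e :: "vec \<times> nat \<times> nat" and X
    by (intro card_image) (simp add: inj_on_def)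
  then have inner: "card (\<Union>l<edge_mult n c (predec v j) j. (\<lambda>p. p @ [(predec v j, j, l)]) ` W (predec v j))
      = edge_mult n c (predec v j) j * card (W (predec v j))" for j
    by (subst card_UN_disjoint) (use fin in auto)
  have "card (W v) = card (if v = (\<lambda>_. 0) then {[] :: (vec \<times> nat \<times> nat) list} else {}) +
    card (\<Union>j\<in>{j\<in>{1..n+1}. v j > 0}. \<Union>l<edge_mult n c (predec v j) j.
       (\<lambda>p. p @ [(predec v j, j, l)]) ` W (predec v j))"
    unfolding W_def
    by (subst awalks_snoc[OF assms], subst card_Un_disjoint) (use fin in \<open>auto simp: W_def\<close>)
  also have "card (\<Union>j\<in>{j\<in>{1..n+1}. v j > 0}. \<Union>l<edge_mult n c (predec v j) j.
       (\<lambda>p. p @ [(predec v j, j, l)]) ` W (predec v j)) =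
     (\<Sum>j\<in>{j\<in>{1..n+1}. v j > 0}. edge_mult n c (predec v j) j * card (W (predec v j)))"
    by (subst card_UN_disjoint) (use fin inner in auto)
  finally show ?thesis by (simp add: A_def apath_E_iff W_def)
qed

text \<open>For \<open>S \<subseteq> {1..n}\<close> this family is closed under predecessors, so the
  recurrence stays inside it.\<close>

definition subset_vec :: "nat \<Rightarrow> nat set \<Rightarrow> nat \<Rightarrow> vec" where
  "subset_vec n S m = (\<lambda>j. if j \<in> S then 1 else 0)(n + 1 := m)"

lemma A_subset_vec_rec:
  assumes S: "S \<subseteq> {1..n}"
  shows "A n c (subset_vec n S m) = (if S = {} \<and> m = 0 then 1 else 0) +
    (if m > 0 then (c (n + 1) + card S) * A n c (subset_vec n S (m - 1)) else 0) +
    (\<Sum>j\<in>S. (c j + m) * A n c (subset_vec n (S - {j}) m))"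
proof -
  define v where "v = subset_vec n S m"
  have fin: "finite S" and n1: "n + 1 \<notin> S" using S finite_subset by auto
  have v: "v \<in> vecs (n + 1)" using S by (auto simp: v_def subset_vec_def vecs_def)
  have v0: "v = (\<lambda>_. 0) \<longleftrightarrow> S = {} \<and> m = 0"
    using n1 by (auto simp: v_def subset_vec_def fun_eq_iff split: if_splits)
  have idx: "{j. j \<in> {1..n+1} \<and> v j > 0} = S \<union> (if m > 0 then {n + 1} else {})"
    using S by (auto simp: v_def subset_vec_def split: if_splits)
  have p1: "predec v j = subset_vec n (S - {j}) m" if "j \<in> S" for j
    using that n1 by (auto simp: v_def subset_vec_def predec_def fun_eq_iff)
  have p2: "predec v (n + 1) = subset_vec n S (m - 1)"
    by (auto simp: v_def subset_vec_def predec_def fun_eq_iff)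
  have e1: "edge_mult n c (subset_vec n (S - {j}) m) j = c j + m" if "j \<in> S" for j
    using that S by (auto simp: edge_mult_def subset_vec_def)
  have "(\<Sum>k=1..n. subset_vec n S (m - 1) k) = (\<Sum>k=1..n. if k \<in> S then 1 else 0)"
    by (intro sum.cong) (auto simp: subset_vec_def)
  also have "\<dots> = card S"
    using S by (simp add: sum.If_cases Int_absorb1 del: One_nat_def)
  finally have e2: "edge_mult n c (subset_vec n S (m - 1)) (n + 1) = c (n + 1) + card S"
    by (simp add: edge_mult_def)
  have "A n c v = (if S = {} \<and> m = 0 then 1 else 0) +
     ((\<Sum>j\<in>S. edge_mult n c (predec v j) j * A n c (predec v j)) +
      (if m > 0 then edge_mult n c (predec v (n + 1)) (n + 1) * A n c (predec v (n + 1)) else 0))"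
    using fin n1 by (subst A_rec[OF v]) (simp only: v0 idx, subst sum.union_disjoint, auto)
  also have "(\<Sum>j\<in>S. edge_mult n c (predec v j) j * A n c (predec v j)) =
      (\<Sum>j\<in>S. (c j + m) * A n c (subset_vec n (S - {j}) m))"
    by (intro sum.cong) (simp_all add: p1 e1)
  finally show ?thesis
    unfolding p2 e2 by (simp add: v_def)
qed

section \<open>The limit\<close>

text \<open>Both sides satisfy the same recurrence: \<open>polar_mult_linear\<close> carries
  \<open>eulerian_poly_Suc_Suc\<close> over to \<open>A_subset_vec_rec\<close>.\<close>

lemma A_subset_vec_eq:
  assumes "S \<subseteq> {1..n}"
  shows "real (A n c (subset_vec n S m)) =
    polar (\<lambda>j. real (c j)) S (eulerian_poly (real (c (n + 1))) (card S) (Suc m))"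
  using assms
proof (induction "card S + m" arbitrary: S m rule: less_induct)
  case less
  define d where "d = real (c (n + 1))"
  have fin: "finite S" using less.prems finite_subset by auto
  show ?case
  proof (cases "card S")
    case 0
    then have "S = {}" using fin by simp
    then show ?thesis
      using less.hyps[of "{}" "m - 1"]
      by (subst A_subset_vec_rec) (cases m; simp add: eulerian_poly_0 polar_empty)+
  next
    case (Suc t)
    then have "S \<noteq> {}" by auto
    \<comment> \<open>At \<open>m = 0\<close> no arc enters in direction \<open>n + 1\<close>; on
      the right this is the vanishing row \<open>eulerian_poly_Suc_0\<close>.\<close>
    have 1: "(if m > 0 then (d + card S) * real (A n c (subset_vec n S (m - 1))) else 0) =
        (d + card S) * polar (\<lambda>j. real (c j)) S (eulerian_poly d (card S) m)"
      using less.hyps[of S "m - 1"] less.prems Suc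
      by (cases m) (simp_all add: eulerian_poly_Suc_0 d_def polar_def[of _ _ 0])
    have 2: "real (A n c (subset_vec n (S - {j}) m)) =
        polar (\<lambda>j. real (c j)) (S - {j}) (eulerian_poly d t (Suc m))" if "j \<in> S" for j
    proof -
      have "card (S - {j}) = t" using that Suc fin by simp
      then show ?thesis using less.hyps[of "S - {j}" m] less.prems Suc by (auto simp: d_def)
    qed
    have "real (A n c (subset_vec n S m)) =
       (if m > 0 then (d + card S) * real (A n c (subset_vec n S (m - 1))) else 0) +
       (\<Sum>j\<in>S. (real (c j) + real m) * real (A n c (subset_vec n (S - {j}) m)))"
      using \<open>S \<noteq> {}\<close> by (subst A_subset_vec_rec[OF less.prems]) (simp add: d_def)
    also have "\<dots> = (d + card S) * polar (\<lambda>j. real (c j)) S (eulerian_poly d (card S) m) +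
       (\<Sum>j\<in>S. (real (c j) + real m) * polar (\<lambda>j. real (c j)) (S - {j}) (eulerian_poly d t (Suc m)))"
      by (simp only: 1 2 cong: sum.cong)
    also have "\<dots> = (d + card S) * polar (\<lambda>j. real (c j)) S (eulerian_poly d (card S) m) +
       real (card S) * polar (\<lambda>j. real (c j)) S ([:real m, 1:] * eulerian_poly d t (Suc m))"
      using polar_mult_linear[OF fin, of "eulerian_poly d t (Suc m)"] degree_eulerian_poly[of d t "Suc m"] Suc
      by simp
    finally show ?thesis
      by (simp add: Suc d_def[simplified, symmetric] eulerian_poly_Suc_Suc polar_add polar_smult
          del: of_nat_Suc mult_pCons_left)
  qed
qed

lemma polar_eulerian_poly_tendsto:
  fixes d :: real
  assumes "finite S" "card S = s" "0 \<le> d" "0 < d + real s"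
  shows "(\<lambda>m. polar c S (eulerian_poly d s (Suc m)) / (d + real s) ^ m) \<longlonglongrightarrow>
    (d + real s) ^ s * polar c S (\<Prod>k<s. [:d + real k, 1:])"
proof -
  define P where "P j m = polar c S (\<Prod>k<s. [:eulerian_shift d (Suc m) j k, 1:])" for j m
  \<comment> \<open>The exponent \<open>s + Suc m - 1\<close> is \<open>s + m\<close>; its part
    \<open>s\<close>, constant in \<open>m\<close>, is kept here.\<close>
  define a where "a j = (-1) ^ (s - j) * real (s choose j) * (d + real j) ^ s" for j
  have "(\<lambda>m. a j * (((d + real j) / (d + real s)) ^ m * P j m)) \<longlonglongrightarrow> 0" if "j < s" for j
  proof -
    define \<alpha> where "\<alpha> k = (if k < j then d else d + 1) + real k" for k
    define \<beta> :: "nat \<Rightarrow> real" where "\<beta> k = (if k < j then 0 else 1)" for k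
    define r where "r = (d + real j) / (d + real s)"
    have r: "0 \<le> r" "r < 1" using that assms by (auto simp: r_def)
    have "eulerian_shift d (Suc m) j k = \<alpha> k + \<beta> k * real m" for m k
      by (simp add: eulerian_shift_def \<alpha>_def \<beta>_def)
    \<comment> \<open>Expanding over orderings of \<open>S\<close> makes each summand a product of
      factors linear in \<open>m\<close>, which the geometric factor with ratio \<open>r < 1\<close>
      dominates.\<close>
    then have "P j m = (\<Sum>xs\<in>permutations_of_set S. \<Prod>k<s. (c (xs ! k) + \<alpha> k) + \<beta> k * real m) / fact s" for m
      using polar_prod_linear[OF assms(1), of c "\<lambda>k. \<alpha> k + \<beta> k * real m"] assms(2)
      by (simp add: P_def field_simps)
    moreover have "(\<lambda>m. a j * ((\<Sum>xs\<in>permutations_of_set S.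
        r ^ m * (\<Prod>k<s. (c (xs ! k) + \<alpha> k) + \<beta> k * real m)) / fact s)) \<longlonglongrightarrow>
        a j * ((\<Sum>xs\<in>permutations_of_set S. 0) / fact s)"
      by (intro tendsto_intros power_mult_prod_linear_tendsto_0 r) simp_all
    ultimately show ?thesis by (simp add: r_def sum_distrib_left)
  qed
  then have "(\<lambda>m. (\<Sum>j<s. a j * (((d + real j) / (d + real s)) ^ m * P j m)) +
       (d + real s) ^ s * polar c S (\<Prod>k<s. [:d + real k, 1:])) \<longlonglongrightarrow>
       (\<Sum>j<s. 0) + (d + real s) ^ s * polar c S (\<Prod>k<s. [:d + real k, 1:])"
    by (intro tendsto_intros) simp
  \<comment> \<open>For \<open>j = s\<close> every index satisfies \<open>k < j\<close>, so the
    shift is free of \<open>m\<close> and this term alone survives.\<close>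
  moreover have "P s m = polar c S (\<Prod>k<s. [:d + real k, 1:])" for m
    unfolding P_def by (intro arg_cong[of _ _ "polar c S"] prod.cong) (simp_all add: eulerian_shift_def)
  moreover have "polar c S (eulerian_poly d s (Suc m)) / (d + real s) ^ m =
      (\<Sum>j\<le>s. a j * (((d + real j) / (d + real s)) ^ m * P j m))" for m
    by (simp add: eulerian_poly_def polar_sum polar_smult P_def a_def sum_divide_distrib power_add power_divide
        mult_ac)
  ultimately show ?thesis
    using assms(4) by (simp add: lessThan_Suc_atMost[symmetric] a_def)
qed

text \<open>A permutation corresponds to its list of values. Lists are indexed from 0 and arguments
  from 1, hence \<open>k - 1\<close>; outside \<open>{1..n}\<close> the inverse map is the identity,
  as \<open>permutes\<close> demands.\<close>

lemma sum_permutations_of_set_atLeastAtMost: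
  "(\<Sum>xs\<in>permutations_of_set {1..n}. \<Prod>k<n. f (xs ! k) k) =
   (\<Sum>\<xi> | \<xi> permutes {1..n}. \<Prod>k=1..n. (f (\<xi> k) (k - 1) :: real))"
proof (rule sum.reindex_bij_witness[of _ "\<lambda>\<xi>. map \<xi> [1..<Suc n]" "\<lambda>xs k. if k \<in> {1..n} then xs ! (k - 1) else k"])
  fix xs assume "xs \<in> permutations_of_set {1..n}"
  then have xs: "set xs = {1..n}" "distinct xs" "length xs = n"
    using length_finite_permutations_of_set[of xs "{1..n}"] by (auto simp: permutations_of_set_def)
  define \<xi> where "\<xi> = (\<lambda>k. if k \<in> {1..n} then xs ! (k - 1) else k)"
  show "map \<xi> [1..<Suc n] = xs"
    using xs by (intro nth_equalityI) (auto simp: \<xi>_def simp del: upt_Suc)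
  have "inj_on \<xi> {1..n}"
    using xs by (auto simp: inj_on_def \<xi>_def nth_eq_iff_index_eq)
  moreover have "\<xi> ` {1..n} \<subseteq> {1..n}"
  proof
    fix y assume "y \<in> \<xi> ` {1..n}"
    then obtain k where "k \<in> {1..n}" "y = xs ! (k - 1)" by (auto simp: \<xi>_def)
    then show "y \<in> {1..n}" using xs nth_mem[of "k - 1" xs] by auto
  qed
  ultimately have "\<xi> ` {1..n} = {1..n}"
    by (simp add: endo_inj_surj)
  with \<open>inj_on \<xi> {1..n}\<close> have "\<xi> permutes {1..n}"
    by (intro bij_imp_permutes) (auto simp: bij_betw_def \<xi>_def)
  then show "\<xi> \<in> {\<xi>. \<xi> permutes {1..n}}" by simp
  show "(\<Prod>k=1..n. f (\<xi> k) (k - 1)) = (\<Prod>k<n. f (xs ! k) k)"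
    by (rule prod.reindex_bij_witness[of _ Suc "\<lambda>k. k - 1"]) (auto simp: \<xi>_def)
next
  fix \<xi> assume "\<xi> \<in> {\<xi>. \<xi> permutes {1..n}}"
  then have \<xi>: "\<xi> permutes {1..n}" by simp
  show "map \<xi> [1..<Suc n] \<in> permutations_of_set {1..n}"
    using permutes_image[OF \<xi>] permutes_inj_on[OF \<xi>]
    by (auto simp: permutations_of_set_def distinct_map atLeastLessThanSuc_atLeastAtMost simp del: upt_Suc)
  show "(\<lambda>k. if k \<in> {1..n} then map \<xi> [1..<Suc n] ! (k - 1) else k) = \<xi>"
    using permutes_not_in[OF \<xi>] by (auto simp: fun_eq_iff simp del: upt_Suc)
qed

theorem theorem2p2:
  fixes n :: nat and c :: "nat \<Rightarrow> nat"
  assumes "n \<ge> 1"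
  shows "(\<lambda>m. real (A n c ((ones n)(n + 1 := m))) / (real (c (n + 1)) + real n) ^ m)
           \<longlonglongrightarrow> B n c (ones n)
       \<and> B n c (ones n) =
           (real (c (n + 1)) + real n) ^ n / fact n *
           (\<Sum>\<xi> | \<xi> permutes {1..n}.
              \<Prod>k=1..n. real (c (\<xi> k)) + real (c (n + 1)) + real k - 1)"
proof -
  define d where "d = real (c (n + 1))"
  define L where "L = (d + real n) ^ n / fact n *
     (\<Sum>\<xi> | \<xi> permutes {1..n}. \<Prod>k=1..n. real (c (\<xi> k)) + d + real k - 1)"
  have "fact n * polar (\<lambda>j. real (c j)) {1..n} (\<Prod>k<n. [:d + real k, 1:]) =
     (\<Sum>xs\<in>permutations_of_set {1..n}. \<Prod>k<n. real (c (xs ! k)) + (d + real k))"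
    using polar_prod_linear[of "{1..n}" "\<lambda>j. real (c j)" "\<lambda>k. d + real k"] by simp
  also have "\<dots> = (\<Sum>\<xi> | \<xi> permutes {1..n}. \<Prod>k=1..n. real (c (\<xi> k)) + (d + real (k - 1)))"
    by (rule sum_permutations_of_set_atLeastAtMost)
  also have "\<dots> = (\<Sum>\<xi> | \<xi> permutes {1..n}. \<Prod>k=1..n. real (c (\<xi> k)) + d + real k - 1)"
    by (intro sum.cong prod.cong) (auto simp: of_nat_diff)
  finally have L: "(d + real n) ^ n * polar (\<lambda>j. real (c j)) {1..n} (\<Prod>k<n. [:d + real k, 1:]) = L"
    by (simp add: L_def field_simps)
  have "ones n = subset_vec n {1..n} 0"
    by (auto simp: ones_def subset_vec_def fun_eq_iff)
  then have "(ones n)(n + 1 := m) = subset_vec n {1..n} m" for m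
    by (simp add: subset_vec_def)
  then have "real (A n c ((ones n)(n + 1 := m))) =
      polar (\<lambda>j. real (c j)) {1..n} (eulerian_poly d n (Suc m))" for m
    using A_subset_vec_eq[of "{1..n}" n c m] by (simp add: d_def)
  \<comment> \<open>\<open>n \<ge> 1\<close> makes the base \<open>d + real n\<close> positive even
    if \<open>d = 0\<close>.\<close>
  moreover have "(\<lambda>m. polar (\<lambda>j. real (c j)) {1..n} (eulerian_poly d n (Suc m)) / (d + real n) ^ m) \<longlonglongrightarrow> L"
    unfolding L[symmetric] using assms by (intro polar_eulerian_poly_tendsto) (auto simp: d_def)
  ultimately have lim: "(\<lambda>m. real (A n c ((ones n)(n + 1 := m))) / (d + real n) ^ m) \<longlonglongrightarrow> L"
    by simp
  moreover have "A_ratio n c (ones n) = (\<lambda>m. real (A n c ((ones n)(n + 1 := m))) / (d + real n) ^ m)"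
    by (simp add: A_ratio_def ones_def d_def fun_eq_iff)
  ultimately have "B n c (ones n) = L"
    by (simp add: B_def limI)
  with lim show ?thesis by (simp add: L_def d_def)
qed

end
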